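(* Let $(V,V^+)$ be an ordered real vector space with order unit $e$, assume $V\neq\{0\}$, and for $v\in V$ let $$\| v \| := \inf \{ r \in \mathbb{R} : re + v \geq 0 \text{ and } re-v \geq 0 \}.$$ Then $\|\cdot\|$ is a seminorm on $V$, and for each $v\in V$, $$\|v\| = \sup \{ |f(v)| : f : V \to \mathbb{R} \text{ is a state} \}.$$ Moreover, when $e$ is an Archimedean order unit, $\|\cdot\|$ is a norm.
   Context: An ordered real vector space $(V,V^+)$ is a real vector space $V$ with a nonempty subset $V^+\subseteq V$ closed under addition and under multiplication by scalars in $[0,\infty)$, such that $V^+\cap -V^+=\{0\}$. One writes $v\ge w$ if $v-w\in V^+$. An element $e\in V$ is an order unit if for each $v\in V$ there is a real $r>0$ with $re\ge v$; it is an Archimedean order unit if, in addition, whenever $v\in V$ satisfies $re+v\ge 0$ for all real $r>0$, then $v\in V^+$. An $\mathbb{R}$-linear functional $f:V\to\mathbb{R}$ is a state if $f(V^+)\subseteq[0,\infty)$ and $f(e)=1$. *)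

theory Defs
  imports Complex_Main
begin

text \<open>
  The vector space \<open>V\<close> is a type of class \<open>real_vector\<close>, and the positive cone \<open>V\<^sup>+\<close> is an
  explicit set \<open>P\<close>, so that one space may carry several cones. (The class
  \<open>ordered_real_vector\<close> would fix a single order per type.)
\<close>

definition ordered_vector_space :: "'a::real_vector set \<Rightarrow> bool" where
  "ordered_vector_space P \<longleftrightarrow>
     P \<noteq> {} \<and>
     (\<forall>v\<in>P. \<forall>w\<in>P. v + w \<in> P) \<and>
     (\<forall>v\<in>P. \<forall>r::real. 0 \<le> r \<longrightarrow> r *\<^sub>R v \<in> P) \<and>
     P \<inter> uminus ` P = {0}"

definition cone_ge :: "'a::real_vector set \<Rightarrow> 'a \<Rightarrow> 'a \<Rightarrow> bool" where
  "cone_ge P v w \<longleftrightarrow> v - w \<in> P"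

definition order_unit :: "'a::real_vector set \<Rightarrow> 'a \<Rightarrow> bool" where
  "order_unit P e \<longleftrightarrow> (\<forall>v. \<exists>r::real. 0 < r \<and> cone_ge P (r *\<^sub>R e) v)"

definition archimedean_order_unit :: "'a::real_vector set \<Rightarrow> 'a \<Rightarrow> bool" where
  "archimedean_order_unit P e \<longleftrightarrow>
     order_unit P e \<and>
     (\<forall>v. (\<forall>r::real. 0 < r \<longrightarrow> cone_ge P (r *\<^sub>R e + v) 0) \<longrightarrow> v \<in> P)"

definition states :: "'a::real_vector set \<Rightarrow> 'a \<Rightarrow> ('a \<Rightarrow> real) set" where
  "states P e = {f. linear f \<and> f ` P \<subseteq> {0..} \<and> f e = 1}"

definition order_bounds :: "'a::real_vector set \<Rightarrow> 'a \<Rightarrow> 'a \<Rightarrow> real set" where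
  "order_bounds P e v = {r. cone_ge P (r *\<^sub>R e + v) 0 \<and> cone_ge P (r *\<^sub>R e - v) 0}"

definition order_norm :: "'a::real_vector set \<Rightarrow> 'a \<Rightarrow> 'a \<Rightarrow> real" where
  "order_norm P e v = Inf (order_bounds P e v)"

definition is_seminorm :: "('a::real_vector \<Rightarrow> real) \<Rightarrow> bool" where
  "is_seminorm p \<longleftrightarrow>
     (\<forall>v. 0 \<le> p v) \<and>
     (\<forall>(r::real) v. p (r *\<^sub>R v) = \<bar>r\<bar> * p v) \<and>
     (\<forall>v w. p (v + w) \<le> p v + p w)"

definition is_norm :: "('a::real_vector \<Rightarrow> real) \<Rightarrow> bool" where
  "is_norm p \<longleftrightarrow> is_seminorm p \<and> (\<forall>v. p v = 0 \<longrightarrow> v = 0)"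

end

theory Submission
  imports Defs
begin

text \<open>
  Put \<open>q v = Inf {r. r e - v \<in> P}\<close>. This is a sublinear functional, every linear functional
  dominated by \<open>q\<close> is a state, and the order seminorm is at most \<open>max (q v) (q (- v))\<close>.
  The Hahn-Banach theorem gives for each \<open>v\<close> a state \<open>f\<close> with \<open>f v = q v\<close>; applied to
  \<open>v\<close> and to \<open>- v\<close> it yields a state \<open>f\<close> such that \<open>\<bar>f v\<bar>\<close> is at least the
  seminorm of \<open>v\<close>. Conversely, if \<open>r e + v\<close> and \<open>r e - v\<close> are positive, then
  \<open>\<bar>f v\<bar> \<le> r\<close> for every state \<open>f\<close>. So the supremum over the states is attained and equals
  the seminorm (\<open>state_attaining_order_norm\<close>).

  Hahn-Banach is obtained from Zorn's lemma applied to sublinear functionals rather than to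
  partial extensions: below every sublinear functional there is a minimal one
  (\<open>minimal_sublinear_exists\<close>), and minimal ones are linear
  (\<open>minimal_sublinear_linear\<close>). The linearity of minimal functionals and the prescribed
  value at \<open>v\<close> both come from one construction, the tilt
  \<open>x \<mapsto> Inf {p (x + t v) - t p v | t \<ge> 0}\<close>, a sublinear functional below \<open>p\<close> whose value at
  \<open>- v\<close> is at most \<open>- p v\<close>.

  Sublinearity of the pointwise infimum of a chain, of the tilt, of \<open>q\<close> and of the order
  seminorm is each time an instance of \<open>sublinear_Inf\<close>.
\<close>

section \<open>Sublinear functionals\<close>

text \<open>
  Subadditive and positively homogeneous real-valued functions. Homogeneity includes the
  scalar \<open>0\<close>, so \<open>p 0 = 0\<close>.
\<close>

definition sublinear :: "('a::real_vector \<Rightarrow> real) \<Rightarrow> bool" where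
  "sublinear p \<longleftrightarrow>
     (\<forall>x y. p (x + y) \<le> p x + p y) \<and> (\<forall>t x. 0 \<le> t \<longrightarrow> p (t *\<^sub>R x) = t * p x)"

lemma sublinear_add: "sublinear p \<Longrightarrow> p (x + y) \<le> p x + p y"
  by (simp add: sublinear_def)

lemma sublinear_scale: "sublinear p \<Longrightarrow> 0 \<le> t \<Longrightarrow> p (t *\<^sub>R x) = t * p x"
  by (simp add: sublinear_def)

lemma sublinear_zero: "sublinear p \<Longrightarrow> p 0 = 0"
  using sublinear_scale[of p 0 0] by simp

lemma sublinear_minus: "sublinear p \<Longrightarrow> - p (- x) \<le> p x"
  using sublinear_add[of p x "- x"] sublinear_zero[of p] by simp

lemma sublinearI:
  assumes add: "\<And>x y. p (x + y) \<le> p x + p y"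
    and scale: "\<And>t x. 0 < t \<Longrightarrow> p (t *\<^sub>R x) \<le> t * p x"
  shows "sublinear p"
  unfolding sublinear_def
proof (intro conjI allI impI)
  have zero: "p 0 = 0"
    using scale[of 2 0] scale[of "1/2" 0] by simp
  fix t :: real and x
  assume "0 \<le> t"
  show "p (t *\<^sub>R x) = t * p x"
  proof (cases "t = 0")
    case True
    then show ?thesis by (simp add: zero)
  next
    case False
    with \<open>0 \<le> t\<close> have t: "0 < t" by simp
    have "p x \<le> inverse t * p (t *\<^sub>R x)"
      using scale[of "inverse t" "t *\<^sub>R x"] t by simp
    then have "t * p x \<le> p (t *\<^sub>R x)"
      using t by (simp add: field_simps)
    with scale[OF t, of x] show ?thesis by simp
  qed
qed (rule add)

text \<open>
  The pointwise infimum of sets of admissible bounds is sublinear as soon as the bounds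
  themselves can be added, up to taking a smaller one, and scaled.
\<close>

lemma sublinear_Inf:
  fixes B :: "'a::real_vector \<Rightarrow> real set"
  assumes ne: "\<And>x. B x \<noteq> {}"
    and bdd: "\<And>x. bdd_below (B x)"
    and add: "\<And>x y a b. a \<in> B x \<Longrightarrow> b \<in> B y \<Longrightarrow> \<exists>c\<in>B (x + y). c \<le> a + b"
    and scale: "\<And>t x a. 0 < t \<Longrightarrow> a \<in> B x \<Longrightarrow> t * a \<in> B (t *\<^sub>R x)"
  shows "sublinear (\<lambda>x. Inf (B x))"
proof (rule sublinearI)
  fix x y
  have *: "Inf (B (x + y)) \<le> a + b" if "a \<in> B x" "b \<in> B y" for a b
    using add[OF that] cInf_lower[OF _ bdd] by (meson order_trans)
  have "Inf (B (x + y)) - b \<le> Inf (B x)" if "b \<in> B y" for b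
    by (rule cInf_greatest[OF ne]) (use *[OF _ that] in \<open>simp add: algebra_simps\<close>)
  then have "Inf (B (x + y)) - Inf (B x) \<le> Inf (B y)"
    by (intro cInf_greatest[OF ne]) (simp add: algebra_simps)
  then show "Inf (B (x + y)) \<le> Inf (B x) + Inf (B y)" by simp
next
  fix t :: real and x
  assume t: "0 < t"
  have "Inf (B (t *\<^sub>R x)) / t \<le> Inf (B x)"
    by (rule cInf_greatest[OF ne])
      (use cInf_lower[OF scale[OF t] bdd] t in \<open>simp add: field_simps\<close>)
  then show "Inf (B (t *\<^sub>R x)) \<le> t * Inf (B x)"
    using t by (simp add: field_simps)
qed

text \<open>
  The witness is the tilt of \<open>p\<close> in the direction \<open>v\<close>.
\<close>

lemma sublinear_tilt_exists:
  assumes p: "sublinear p"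
  obtains p' where "sublinear p'" "\<And>x. p' x \<le> p x" "p' (- v) \<le> - p v"
proof
  define B where "B x = {p (x + t *\<^sub>R v) - t * p v | t. 0 \<le> t}" for x
  define p' where "p' x = Inf (B x)" for x
  have mem: "p (x + t *\<^sub>R v) - t * p v \<in> B x" if "0 \<le> t" for x t
    using that by (auto simp: B_def)
  have "- p (- x) \<le> b" if "b \<in> B x" for x b
  proof -
    from that obtain t where t: "0 \<le> t" and b: "b = p (x + t *\<^sub>R v) - t * p v"
      by (auto simp: B_def)
    have "t * p v \<le> p (x + t *\<^sub>R v) + p (- x)"
      using sublinear_add[OF p, of "x + t *\<^sub>R v" "- x"] sublinear_scale[OF p t] by simp
    then show ?thesis by (simp add: b)
  qed
  then have bdd: "bdd_below (B x)" for x
    by (rule bdd_belowI)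
  have lower: "p' x \<le> p (x + t *\<^sub>R v) - t * p v" if "0 \<le> t" for x t
    unfolding p'_def by (rule cInf_lower[OF mem[OF that] bdd])
  show "sublinear p'"
    unfolding p'_def
  proof (rule sublinear_Inf[OF _ bdd])
    show "B x \<noteq> {}" for x
      using mem[of 0] by auto
  next
    fix x y a b
    assume "a \<in> B x" "b \<in> B y"
    then obtain s t where st: "0 \<le> s" "0 \<le> t" and
      a: "a = p (x + s *\<^sub>R v) - s * p v" and b: "b = p (y + t *\<^sub>R v) - t * p v"
      by (auto simp: B_def)
    have "p ((x + y) + (s + t) *\<^sub>R v) \<le> p (x + s *\<^sub>R v) + p (y + t *\<^sub>R v)"
      using sublinear_add[OF p, of "x + s *\<^sub>R v" "y + t *\<^sub>R v"] by (simp add: algebra_simps)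
    then have "p ((x + y) + (s + t) *\<^sub>R v) - (s + t) * p v \<le> a + b"
      by (simp add: a b algebra_simps)
    then show "\<exists>c\<in>B (x + y). c \<le> a + b"
      using mem[of "s + t" "x + y"] st by auto
  next
    fix t x a
    assume t: "(0::real) < t" and "a \<in> B x"
    then obtain s where s: "0 \<le> s" and a: "a = p (x + s *\<^sub>R v) - s * p v"
      by (auto simp: B_def)
    have "t * a = p (t *\<^sub>R x + (t * s) *\<^sub>R v) - (t * s) * p v"
      using sublinear_scale[OF p, of t "x + s *\<^sub>R v"] t by (simp add: a algebra_simps)
    then show "t * a \<in> B (t *\<^sub>R x)"
      using mem[of "t * s" "t *\<^sub>R x"] s t by simp
  qed
  show "p' x \<le> p x" for x
    using lower[of 0 x] by simp
  show "p' (- v) \<le> - p v"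
    using lower[of 1 "- v"] sublinear_zero[OF p] by simp
qed

lemma minimal_sublinear_exists:
  fixes q :: "'a::real_vector \<Rightarrow> real"
  assumes q: "sublinear q"
  obtains p where "sublinear p" "p \<le> q" "\<And>p'. sublinear p' \<Longrightarrow> p' \<le> p \<Longrightarrow> p' = p"
proof -
  define A where "A = {p. sublinear p \<and> p \<le> q}"
  let ?R = "relation_of (\<lambda>f g. g \<le> f) A"
  have "partial_order_on A ?R"
    by (rule partial_order_on_relation_ofI) auto
  moreover have "\<exists>u\<in>A. \<forall>a\<in>C. u \<le> a" if C: "C \<in> Chains ?R" for C
  proof (cases "C = {}")
    case True
    then show ?thesis using q by (auto simp: A_def)
  next
    case False
    have CA: "\<And>p. p \<in> C \<Longrightarrow> sublinear p \<and> p \<le> q"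
      and tot: "\<And>p p'. p \<in> C \<Longrightarrow> p' \<in> C \<Longrightarrow> p \<le> p' \<or> p' \<le> p"
      using C by (auto simp: Chains_def relation_of_def A_def)
    define B where "B x = (\<lambda>p. p x) ` C" for x
    have "- q (- x) \<le> p x" if "p \<in> C" for p x
    proof -
      have "p (- x) \<le> q (- x)"
        using CA[OF that] by (simp add: le_fun_def)
      then show ?thesis
        using sublinear_minus[of p x] CA[OF that] by simp
    qed
    then have bdd: "bdd_below (B x)" for x
      by (intro bdd_belowI[of _ "- q (- x)"]) (auto simp: B_def)
    have lower: "Inf (B x) \<le> p x" if "p \<in> C" for p x
      by (rule cInf_lower[OF _ bdd]) (use that in \<open>auto simp: B_def\<close>)
    have "sublinear (\<lambda>x. Inf (B x))"
    proof (rule sublinear_Inf[OF _ bdd])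
      show "B x \<noteq> {}" for x
        using False by (simp add: B_def)
    next
      fix x y a b
      assume "a \<in> B x" "b \<in> B y"
      then obtain p p' where pp: "p \<in> C" "p' \<in> C" and ab: "a = p x" "b = p' y"
        by (auto simp: B_def)
      \<comment> \<open>The smaller of the two members of the chain bounds both values from below.\<close>
      obtain r where r: "r \<in> C" "r \<le> p" "r \<le> p'"
        using tot[OF pp] pp by blast
      have "r (x + y) \<le> r x + r y"
        using CA[OF r(1)] by (simp add: sublinear_add)
      also have "\<dots> \<le> a + b"
        using r by (auto simp: ab le_fun_def intro: add_mono)
      finally show "\<exists>c\<in>B (x + y). c \<le> a + b"
        using r(1) by (auto simp: B_def)
    next
      fix t x a
      assume "(0::real) < t" "a \<in> B x"
      then show "t * a \<in> B (t *\<^sub>R x)"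
        using CA by (auto simp: B_def sublinear_scale intro!: image_eqI)
    qed
    moreover obtain p0 where "p0 \<in> C" using False by blast
    then have "(\<lambda>x. Inf (B x)) \<le> q"
      using lower[of p0] CA[of p0] by (meson le_funI le_funD order_trans)
    ultimately show ?thesis
      using lower by (intro bexI[of _ "\<lambda>x. Inf (B x)"]) (auto simp: A_def le_fun_def)
  qed
  ultimately obtain p where "p \<in> A" "\<forall>p'\<in>A. p' \<le> p \<longrightarrow> p' = p"
    using predicate_Zorn[of A "\<lambda>f g. g \<le> f"] by auto
  then show thesis
    using that[of p] by (auto simp: A_def dest: order_trans)
qed

text \<open>
  The tilt of a minimal sublinear functional \<open>p\<close> is \<open>p\<close> itself, so \<open>p\<close> is odd; an odd
  sublinear functional is linear.
\<close>

lemma minimal_sublinear_linear: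
  assumes p: "sublinear p"
    and min: "\<And>p'. sublinear p' \<Longrightarrow> p' \<le> p \<Longrightarrow> p' = p"
  shows "linear p"
proof -
  have odd: "p (- x) = - p x" for x
  proof -
    obtain p' where "sublinear p'" "\<And>y. p' y \<le> p y" "p' (- x) \<le> - p x"
      using sublinear_tilt_exists[OF p, where v = x] by blast
    then have "p (- x) \<le> - p x"
      using min[of p'] by (simp add: le_fun_def)
    with sublinear_minus[OF p, of x] show ?thesis by simp
  qed
  show ?thesis
  proof (rule linearI)
    fix x y
    show "p (x + y) = p x + p y"
      using sublinear_add[OF p, of x y] sublinear_add[OF p, of "- x" "- y"] odd[of "x + y"]
      by (simp add: odd)
  next
    fix t x
    show "p (t *\<^sub>R x) = t *\<^sub>R p x"
    proof (cases "0 \<le> t")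
      case True
      then show ?thesis by (simp add: sublinear_scale[OF p])
    next
      case False
      then have "p ((- t) *\<^sub>R x) = (- t) * p x"
        by (intro sublinear_scale[OF p]) simp
      then show ?thesis by (simp add: odd)
    qed
  qed
qed

text \<open>
  The Hahn-Banach theorem for sublinear functionals, in the form of a supporting functional
  at a given point.
\<close>

lemma supporting_linear_functional_exists:
  fixes q :: "'a::real_vector \<Rightarrow> real"
  assumes q: "sublinear q"
  obtains f where "linear f" "\<And>x. f x \<le> q x" "f v = q v"
proof -
  obtain q' where q': "sublinear q'" "\<And>x. q' x \<le> q x" "q' (- v) \<le> - q v"
    using sublinear_tilt_exists[OF q, where v = v] by blast
  obtain f where f: "sublinear f" "f \<le> q'" "\<And>p'. sublinear p' \<Longrightarrow> p' \<le> f \<Longrightarrow> p' = f"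
    using minimal_sublinear_exists[OF q'(1)] by blast
  have lin: "linear f"
    using f by (intro minimal_sublinear_linear)
  have le: "f x \<le> q x" for x
    using le_funD[OF f(2), of x] q'(2)[of x] by simp
  have "- f v \<le> - q v"
    using le_funD[OF f(2), of "- v"] q'(3) linear_neg[OF lin, of v] by simp
  with le[of v] have "f v = q v" by simp
  with lin le show thesis by (rule that)
qed

section \<open>Ordered vector spaces with an order unit\<close>

text \<open>
  The cone is a parameter, not a class order, and \<open>V \<noteq> {0}\<close> is used exactly to obtain
  \<open>e \<noteq> 0\<close>, equivalently that no negative multiple of \<open>e\<close> is positive.
\<close>

locale order_unit_space =
  fixes P :: "'a::real_vector set" and e :: 'a
  assumes ordered: "ordered_vector_space P"
    and unit: "order_unit P e"
    and nontrivial: "(UNIV :: 'a set) \<noteq> {0}"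
begin

lemma cone_add: "v \<in> P \<Longrightarrow> w \<in> P \<Longrightarrow> v + w \<in> P"
  using ordered by (simp add: ordered_vector_space_def)

lemma cone_scale: "v \<in> P \<Longrightarrow> 0 \<le> r \<Longrightarrow> r *\<^sub>R v \<in> P"
  using ordered by (simp add: ordered_vector_space_def)

lemma cone_antisym:
  assumes "v \<in> P" "- v \<in> P"
  shows "v = 0"
proof -
  have "v \<in> P \<inter> uminus ` P"
    using assms by (metis IntI image_eqI minus_minus)
  also have "\<dots> = {0}"
    using ordered by (simp add: ordered_vector_space_def)
  finally show ?thesis by simp
qed

lemma zero_in_cone: "0 \<in> P"
  using ordered by (auto simp: ordered_vector_space_def)

lemma unit_bound_exists:
  obtains r where "0 < r" "r *\<^sub>R e - v \<in> P"
  using unit by (auto simp: order_unit_def cone_ge_def)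

lemma unit_in_cone: "e \<in> P"
proof -
  obtain r where "0 < r" "r *\<^sub>R e \<in> P"
    using unit_bound_exists[of 0] by auto
  then show ?thesis
    using cone_scale[of "r *\<^sub>R e" "inverse r"] by simp
qed

lemma unit_nonzero: "e \<noteq> 0"
proof
  assume "e = 0"
  then have neg: "- v \<in> P" for v
    using unit_bound_exists[of v] by auto
  have "v = 0" for v :: 'a
    using cone_antisym[of v] neg[of v] neg[of "- v"] by simp
  with nontrivial show False by auto
qed

lemma scaled_unit_in_cone_iff: "r *\<^sub>R e \<in> P \<longleftrightarrow> 0 \<le> r"
proof
  assume r: "r *\<^sub>R e \<in> P"
  show "0 \<le> r"
  proof (rule ccontr)
    assume "\<not> 0 \<le> r"
    then have "- e \<in> P"
      using cone_scale[OF r, of "inverse (- r)"] by simp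
    with unit_in_cone cone_antisym unit_nonzero show False by blast
  qed
qed (use unit_in_cone cone_scale in blast)

lemma upper_bound_mono:
  assumes "r *\<^sub>R e + v \<in> P" "r \<le> s"
  shows "s *\<^sub>R e + v \<in> P"
proof -
  have "(r *\<^sub>R e + v) + (s - r) *\<^sub>R e \<in> P"
    using assms(2) by (intro cone_add assms(1)) (simp add: scaled_unit_in_cone_iff)
  then show ?thesis by (simp add: algebra_simps)
qed

subsection \<open>The upper functional and the states\<close>

text \<open>
  The least scalar \<open>r\<close>, up to an infimum, such that \<open>r e\<close> dominates the given vector.
\<close>

definition upper :: "'a \<Rightarrow> real" where
  "upper v = Inf {r. r *\<^sub>R e - v \<in> P}"

lemma upper_set_nonempty: "{r. r *\<^sub>R e - v \<in> P} \<noteq> {}"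
  using unit_bound_exists[of v] by auto

lemma upper_set_bdd_below: "bdd_below {r. r *\<^sub>R e - v \<in> P}"
proof -
  obtain s where s: "s *\<^sub>R e - (- v) \<in> P"
    using unit_bound_exists by blast
  have "- s \<le> r" if "r *\<^sub>R e - v \<in> P" for r
  proof -
    have "(r + s) *\<^sub>R e \<in> P"
      using cone_add[OF that s] by (simp add: algebra_simps)
    then show ?thesis by (simp add: scaled_unit_in_cone_iff)
  qed
  then show ?thesis by (intro bdd_belowI[of _ "- s"]) simp
qed

lemma upper_le: "r *\<^sub>R e - v \<in> P \<Longrightarrow> upper v \<le> r"
  unfolding upper_def by (rule cInf_lower[OF _ upper_set_bdd_below]) simp

lemma in_cone_if_upper_less:
  assumes "upper v < r"
  shows "r *\<^sub>R e - v \<in> P"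
proof -
  obtain s where "s *\<^sub>R e - v \<in> P" "s < r"
    using cInf_lessD[OF upper_set_nonempty] assms unfolding upper_def by blast
  then show ?thesis
    using upper_bound_mono[of s "- v" r] by simp
qed

lemma sublinear_upper: "sublinear upper"
  unfolding upper_def
proof (rule sublinear_Inf[OF upper_set_nonempty upper_set_bdd_below])
  fix x y :: 'a and a b :: real
  assume "a \<in> {r. r *\<^sub>R e - x \<in> P}" "b \<in> {r. r *\<^sub>R e - y \<in> P}"
  then have "(a + b) *\<^sub>R e - (x + y) \<in> P"
    using cone_add[of "a *\<^sub>R e - x" "b *\<^sub>R e - y"] by (simp add: algebra_simps)
  then show "\<exists>c\<in>{r. r *\<^sub>R e - (x + y) \<in> P}. c \<le> a + b" by auto
next
  fix t :: real and x :: 'a and a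
  assume "0 < t" "a \<in> {r. r *\<^sub>R e - x \<in> P}"
  then show "t * a \<in> {r. r *\<^sub>R e - t *\<^sub>R x \<in> P}"
    using cone_scale[of "a *\<^sub>R e - x" t] by (simp add: algebra_simps)
qed

lemma state_if_le_upper:
  assumes f: "linear f" and le: "\<And>x. f x \<le> upper x"
  shows "f \<in> states P e"
proof -
  have bound: "f v \<le> r" if "r *\<^sub>R e - v \<in> P" for v r
    using le[of v] upper_le[OF that] by simp
  have "0 \<le> f v" if "v \<in> P" for v
    using bound[of 0 "- v"] that by (simp add: linear_neg[OF f])
  moreover have "f e \<le> 1" "- f e \<le> - 1"
    using bound[of 1 e] bound[of "- 1" "- e"] zero_in_cone by (simp_all add: linear_neg[OF f])
  ultimately show ?thesis
    using f by (auto simp: states_def)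
qed

lemma state_attaining_upper:
  obtains f where "f \<in> states P e" "f v = upper v"
proof (rule supporting_linear_functional_exists[OF sublinear_upper, where v = v])
  fix f
  assume "linear f" "\<And>x. f x \<le> upper x" "f v = upper v"
  then show thesis
    by (intro that[of f] state_if_le_upper)
qed

subsection \<open>The order seminorm\<close>

lemma mem_order_bounds: "r \<in> order_bounds P e v \<longleftrightarrow> r *\<^sub>R e + v \<in> P \<and> r *\<^sub>R e - v \<in> P"
  by (simp add: order_bounds_def cone_ge_def)

lemma order_bounds_nonneg:
  assumes "r \<in> order_bounds P e v"
  shows "0 \<le> r"
proof -
  have "(r + r) *\<^sub>R e \<in> P"
    using cone_add[of "r *\<^sub>R e + v" "r *\<^sub>R e - v"] assms
    unfolding mem_order_bounds scaleR_add_left by simp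
  then show ?thesis by (simp add: scaled_unit_in_cone_iff)
qed

lemma order_bounds_bdd_below: "bdd_below (order_bounds P e v)"
  using order_bounds_nonneg by (rule bdd_belowI)

lemma in_order_bounds_if_upper_less:
  "upper v < r \<Longrightarrow> upper (- v) < r \<Longrightarrow> r \<in> order_bounds P e v"
  using in_cone_if_upper_less[of v r] in_cone_if_upper_less[of "- v" r]
  by (simp add: mem_order_bounds)

lemma order_bounds_nonempty: "order_bounds P e v \<noteq> {}"
proof -
  have "max (upper v) (upper (- v)) + 1 \<in> order_bounds P e v"
    by (rule in_order_bounds_if_upper_less) linarith+
  then show ?thesis by blast
qed

lemma order_norm_le: "r \<in> order_bounds P e v \<Longrightarrow> order_norm P e v \<le> r"
  unfolding order_norm_def by (rule cInf_lower[OF _ order_bounds_bdd_below])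

lemma order_norm_le_max_upper: "order_norm P e v \<le> max (upper v) (upper (- v))"
  by (rule dense_ge) (simp add: order_norm_le in_order_bounds_if_upper_less)

lemma sublinear_order_norm: "sublinear (order_norm P e)"
  unfolding order_norm_def
proof (rule sublinear_Inf[OF order_bounds_nonempty order_bounds_bdd_below])
  fix x y a b
  assume "a \<in> order_bounds P e x" "b \<in> order_bounds P e y"
  then have "a + b \<in> order_bounds P e (x + y)"
    using cone_add[of "a *\<^sub>R e + x" "b *\<^sub>R e + y"] cone_add[of "a *\<^sub>R e - x" "b *\<^sub>R e - y"]
    by (simp add: mem_order_bounds algebra_simps)
  then show "\<exists>c\<in>order_bounds P e (x + y). c \<le> a + b" by auto
next
  fix t x a
  assume "(0::real) < t" "a \<in> order_bounds P e x"
  then show "t * a \<in> order_bounds P e (t *\<^sub>R x)"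
    using cone_scale[of "a *\<^sub>R e + x" t] cone_scale[of "a *\<^sub>R e - x" t]
    by (simp add: mem_order_bounds algebra_simps)
qed

lemma order_norm_minus: "order_norm P e (- v) = order_norm P e v"
  unfolding order_norm_def by (rule arg_cong[of _ _ Inf]) (auto simp: mem_order_bounds)

lemma is_seminorm_order_norm: "is_seminorm (order_norm P e)"
  unfolding is_seminorm_def
proof (intro conjI allI)
  show "0 \<le> order_norm P e v" for v
    unfolding order_norm_def
    by (rule cInf_greatest[OF order_bounds_nonempty]) (rule order_bounds_nonneg)
  show "order_norm P e (r *\<^sub>R v) = \<bar>r\<bar> * order_norm P e v" for r v
    using sublinear_scale[OF sublinear_order_norm, of "\<bar>r\<bar>" v] order_norm_minus[of "r *\<^sub>R v"]
    by (cases "0 \<le> r") simp_all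
  show "order_norm P e (v + w) \<le> order_norm P e v + order_norm P e w" for v w
    by (rule sublinear_add[OF sublinear_order_norm])
qed

lemma abs_state_le_order_norm:
  assumes "f \<in> states P e"
  shows "\<bar>f v\<bar> \<le> order_norm P e v"
  unfolding order_norm_def
proof (rule cInf_greatest[OF order_bounds_nonempty])
  have f: "linear f" "\<And>x. x \<in> P \<Longrightarrow> 0 \<le> f x" "f e = 1"
    using assms by (auto simp: states_def)
  fix r
  assume "r \<in> order_bounds P e v"
  then have "0 \<le> f (r *\<^sub>R e + v)" "0 \<le> f (r *\<^sub>R e - v)"
    by (simp_all add: mem_order_bounds f(2))
  then show "\<bar>f v\<bar> \<le> r"
    by (simp add: linear_add[OF f(1)] linear_diff[OF f(1)] linear_scale[OF f(1)] f(3))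
qed

lemma state_attaining_order_norm:
  obtains f where "f \<in> states P e" "\<bar>f v\<bar> = order_norm P e v"
proof -
  obtain f where f: "f \<in> states P e" "f v = upper v"
    by (rule state_attaining_upper)
  obtain g where g: "g \<in> states P e" "g (- v) = upper (- v)"
    by (rule state_attaining_upper)
  have "g (- v) = - g v"
    using g(1) by (auto simp: states_def linear_neg)
  then have "order_norm P e v \<le> \<bar>f v\<bar> \<or> order_norm P e v \<le> \<bar>g v\<bar>"
    using order_norm_le_max_upper[of v] f(2) g(2) by linarith
  then show thesis
    using that f(1) g(1) abs_state_le_order_norm by (meson order_antisym)
qed

lemma is_norm_order_norm:
  assumes "archimedean_order_unit P e"
  shows "is_norm (order_norm P e)"
  unfolding is_norm_def
proof (intro conjI allI impI is_seminorm_order_norm)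
  have pos: "v \<in> P" if norm_zero: "order_norm P e v = 0" for v
  proof -
    have "r *\<^sub>R e + v \<in> P" if "0 < r" for r
    proof -
      obtain s where "s \<in> order_bounds P e v" "s < r"
        using cInf_lessD[OF order_bounds_nonempty, of v r] norm_zero \<open>0 < r\<close>
        unfolding order_norm_def by auto
      then show ?thesis
        using upper_bound_mono[of s v r] by (simp add: mem_order_bounds)
    qed
    then show ?thesis
      using assms by (simp add: archimedean_order_unit_def cone_ge_def)
  qed
  fix v
  assume "order_norm P e v = 0"
  then show "v = 0"
    using pos[of v] pos[of "- v"] by (simp add: order_norm_minus cone_antisym)
qed

end

(* Inf and Sup on the reals are meaningful only for nonempty bounded sets; the
   nonemptiness and boundedness conjuncts make "inf" and "sup" genuine. *)
theorem proposition2p23: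
  fixes P :: "'a::real_vector set" and e :: 'a
  assumes "ordered_vector_space P"
    and "order_unit P e"
    and "(UNIV :: 'a set) \<noteq> {0}"
  shows "(\<forall>v. order_bounds P e v \<noteq> {} \<and> bdd_below (order_bounds P e v)) \<and>
    is_seminorm (order_norm P e) \<and>
    (\<forall>v. states P e \<noteq> {} \<and>
         bdd_above {\<bar>f v\<bar> | f. f \<in> states P e} \<and>
         order_norm P e v = Sup {\<bar>f v\<bar> | f. f \<in> states P e}) \<and>
    (archimedean_order_unit P e \<longrightarrow> is_norm (order_norm P e))"
proof -
  interpret order_unit_space P e
    by unfold_locales fact+
  have max: "\<bar>f v\<bar> \<le> order_norm P e v" if "f \<in> states P e" for f v
    using that by (rule abs_state_le_order_norm)
  have "states P e \<noteq> {} \<and> bdd_above {\<bar>f v\<bar> | f. f \<in> states P e} \<and>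
    order_norm P e v = Sup {\<bar>f v\<bar> | f. f \<in> states P e}" for v
  proof -
    obtain f where f: "f \<in> states P e" "\<bar>f v\<bar> = order_norm P e v"
      by (rule state_attaining_order_norm)
    have "Sup {\<bar>f v\<bar> | f. f \<in> states P e} = order_norm P e v"
      by (rule cSup_eq_maximum) (use f max in \<open>auto intro: sym\<close>)
    moreover have "bdd_above {\<bar>f v\<bar> | f. f \<in> states P e}"
      by (intro bdd_aboveI[of _ "order_norm P e v"]) (use max in auto)
    ultimately show ?thesis
      using f(1) by auto
  qed
  then show ?thesis
    by (intro conjI allI impI order_bounds_nonempty order_bounds_bdd_below
        is_seminorm_order_norm is_norm_order_norm) simp_all
qed

end
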